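(* For every finite coloring of $\mathbb{N}$, every $s\in\mathbb{N}$, and every polynomial $P\in\mathbb{Z}[y]$ satisfying $P(0)=0$, there exist infinitely many pairs $(x,y)\in\mathbb{N}^2$ with $x>y\geq 2$ such that $\{x,\;x+P(y),\;xy^s\}$ is monochromatic.
   Context: $\mathbb{N}=\{1,2,3,\ldots\}$. A finite coloring of $\mathbb{N}$ is a partition of $\mathbb{N}$ into finitely many classes (colors); a set is monochromatic if it is a subset of $\mathbb{N}$ contained in a single color class (in particular $x+P(y)\in\mathbb{N}$). *)

theory Defs
  imports "HOL-Library.Disjoint_Sets" "HOL-Computational_Algebra.Polynomial"
begin

definition finite_coloring :: "nat set set \<Rightarrow> bool" where
  "finite_coloring C \<longleftrightarrow> finite C \<and> partition_on {1..} C"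

text \<open>
  The set \<open>S\<close> consists of integers because \<open>x + P(y)\<close> may a priori be nonpositive.
  As the classes of \<open>C\<close> contain only positive integers, a monochromatic set does too.
\<close>

definition monochromatic :: "nat set set \<Rightarrow> int set \<Rightarrow> bool" where
  "monochromatic C S \<longleftrightarrow> (\<exists>A\<in>C. S \<subseteq> int ` A)"

end

theory Submission
  imports Defs "HOL-Library.Multiset"
begin

text \<open>
  The proof follows Moreira's colour-repetition argument for sums and products, with the polynomial
  van der Waerden theorem supplying the additive part.

  Call a set of integers large if it is piecewise syndetic towards \<open>+\<infinity>\<close>.  Largeness survives
  dilation, one part of a finite partition of a large set is large, and for a large \<open>B\<close> and finitely
  many polynomials \<open>f\<close> without constant term some \<open>d \<ge> 1\<close> leaves
  \<open>{b \<in> B. \<forall>f. b + f(d) \<in> B}\<close> large (\<open>piecewise_syndetic_polynomial_recurrence\<close>).  Only the last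
  fact is deep; it is the polynomial van der Waerden theorem applied inside long windows.

  Keep a large set \<open>B\<close> together with colour classes \<open>A\<close> and multipliers \<open>u A\<close> such that
  \<open>B \<subseteq> (u A)^s A\<close> for each of these classes.  Recurrence for the polynomials
  \<open>(u A)^s P(u A \<cdot> y)\<close> gives \<open>y \<ge> 2\<close> and a large \<open>D \<subseteq> B\<close> with \<open>d + (u A)^s P(u A \<cdot> y) \<in> B\<close> for
  \<open>d \<in> D\<close>.  Some class \<open>A\<close> meets \<open>y^s D\<close> in a large set.  If \<open>A\<close> was already recorded, write
  \<open>d = (u A)^s x\<close> and \<open>Y = u A \<cdot> y\<close>: then \<open>x \<in> A\<close>, also \<open>x + P(Y) \<in> A\<close> because
  \<open>(u A)^s (x + P(Y)) \<in> B\<close>, and \<open>x Y^s = y^s d \<in> A\<close>.  Otherwise \<open>A\<close> is recorded with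
  multiplier \<open>1\<close>, the old multipliers are multiplied by \<open>y\<close>, and the large set becomes the part of
  \<open>y^s D\<close> in \<open>A\<close>.  As there are finitely many colours, the first case must occur
  (\<open>tower_step\<close>, \<open>abundant_triples_in_some_class\<close>).  There \<open>Y\<close> is fixed while \<open>x\<close> is unbounded,
  which yields infinitely many pairs and \<open>x > y\<close>.

  The polynomial van der Waerden theorem is proved by colour focusing, following Walters.  A family
  of polynomials is replaced by differences \<open>p(x + t) - p(t) - p\<^sub>1(x)\<close> with \<open>p\<^sub>1\<close> of least degree;
  this lowers a weight in a well-founded order (\<open>poly_weight_shift_family\<close>), and the theorem for the
  new family produces progressions of one more colour aimed at a common focus
  (\<open>color_focusing_step\<close>), until the colours run out.
\<close>

section \<open>The polynomial van der Waerden theorem\<close>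

definition mono_config :: "int poly set \<Rightarrow> (int \<Rightarrow> nat) \<Rightarrow> int \<Rightarrow> bool" where
  "mono_config F \<chi> N \<longleftrightarrow>
     (\<exists>a d. \<bar>a\<bar> \<le> N \<and> 1 \<le> d \<and> d \<le> N \<and> (\<forall>p\<in>F. \<chi> (a + poly p d) = \<chi> a))"

text \<open>
  The bound \<open>N\<close> must not depend on the colouring: the induction colours each integer by the pattern
  of a given colouring on a window around it, and the window must be long enough for all colourings.
\<close>

definition poly_vdw :: "int poly set \<Rightarrow> bool" where
  "poly_vdw F \<longleftrightarrow> (\<forall>r. \<exists>N. \<forall>\<chi>. (\<forall>n. \<chi> n < r) \<longrightarrow> mono_config F \<chi> N)"

definition leading_class :: "int poly \<Rightarrow> nat \<times> int" where
  "leading_class p = (degree p, lead_coeff p)"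

text \<open>
  The weight vector of polynomial exhaustion induction, which counts for each degree the classes of
  polynomials with the same degree and leading coefficient.  As a multiset of degrees, it is compared
  lexicographically from the highest degree down by the multiset order, which is known to be
  well-founded.
\<close>

definition poly_weight :: "int poly set \<Rightarrow> nat multiset" where
  "poly_weight F = image_mset fst (mset_set (leading_class ` F))"

definition shift_diff :: "int poly \<Rightarrow> int poly \<Rightarrow> int \<Rightarrow> int poly" where
  "shift_diff p\<^sub>1 p t = pcompose p [:t, 1:] - [:poly p t:] - p\<^sub>1"

text \<open>The zero polynomial imposes no condition on a configuration, but it would count in the weight.\<close>

definition shift_family :: "int poly \<Rightarrow> int poly set \<Rightarrow> int set \<Rightarrow> int poly set" where
  "shift_family p\<^sub>1 F T = (\<lambda>(p, t). shift_diff p\<^sub>1 p t) ` (F \<times> T) - {0}"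

lemma poly_shift_diff: "poly (shift_diff p\<^sub>1 p t) x = poly p (x + t) - poly p t - poly p\<^sub>1 x"
  by (simp add: shift_diff_def poly_pcompose add.commute)

lemma degree_pos_of_root_zero:
  fixes p :: "int poly"
  assumes "poly p 0 = 0" "p \<noteq> 0"
  shows "degree p > 0"
proof (rule ccontr)
  assume "\<not> degree p > 0"
  then obtain c where "p = [:c:]" by (metis degree_eq_zeroE gr0I)
  with assms show False by simp
qed

text \<open>A translation does not change the leading term, so that term changes only by that of \<open>p\<^sub>1\<close>.\<close>

lemma shift_diff_coeff_ge:
  fixes p :: "int poly"
  assumes "poly p 0 = 0" "p \<noteq> 0" "degree p \<ge> degree p\<^sub>1"
  shows "degree (shift_diff p\<^sub>1 p t) \<le> degree p"
    and "coeff (shift_diff p\<^sub>1 p t) (degree p) = lead_coeff p - coeff p\<^sub>1 (degree p)"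
proof -
  have pos: "degree p > 0" using assms degree_pos_of_root_zero by blast
  have d: "degree (pcompose p [:t, 1:]) = degree p" by (simp add: degree_pcompose)
  have "lead_coeff (pcompose p [:t, 1:]) = lead_coeff p" by (simp add: lead_coeff_comp)
  then have c: "coeff (pcompose p [:t, 1:]) (degree p) = lead_coeff p" by (simp add: d)
  show "degree (shift_diff p\<^sub>1 p t) \<le> degree p"
    unfolding shift_diff_def using assms d by (intro degree_diff_le) auto
  show "coeff (shift_diff p\<^sub>1 p t) (degree p) = lead_coeff p - coeff p\<^sub>1 (degree p)"
    using pos c by (simp add: shift_diff_def coeff_pCons split: nat.split)
qed

text \<open>
  Let \<open>e\<close> be the degree of \<open>p\<^sub>1\<close>.  No new class appears in a degree above \<open>e\<close>.  In degree \<open>e\<close> all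
  leading coefficients are lowered by that of \<open>p\<^sub>1\<close>, which is injective, and the class of \<open>p\<^sub>1\<close> itself
  drops to lower degree.  Thus one copy of \<open>e\<close> is traded for arbitrarily many smaller degrees.
  The map \<open>g\<close> below expresses this correspondence of classes.
\<close>

lemma poly_weight_shift_family:
  assumes fin: "finite F" "finite T" and nz: "0 \<notin> F"
    and p1: "p\<^sub>1 \<in> F" and min: "\<And>p. p \<in> F \<Longrightarrow> degree p\<^sub>1 \<le> degree p"
    and root: "\<And>p. p \<in> F \<Longrightarrow> poly p 0 = 0"
  shows "(poly_weight (shift_family p\<^sub>1 F T), poly_weight F) \<in> mult less_than"
proof -
  define e where "e = degree p\<^sub>1"
  define c\<^sub>1 where "c\<^sub>1 = lead_coeff p\<^sub>1"
  define S where "S = leading_class ` F"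
  define S' where "S' = leading_class ` shift_family p\<^sub>1 F T"
  define g where "g = (\<lambda>(d, c). if d = e then (d, c - c\<^sub>1) else (d, c :: int))"
  define hi where "hi = {x \<in> S'. e \<le> fst x}"
  define lo where "lo = {x \<in> S'. fst x < e}"
  define R where "R = {x \<in> S - {(e, c\<^sub>1)}. g x \<in> hi}"
  have finS: "finite S" "finite S'"
    using fin by (auto simp: S_def S'_def shift_family_def)
  have inj: "inj g" by (auto simp: inj_on_def g_def split: if_splits)
  have fst_g: "fst (g x) = fst x" for x by (cases x) (simp add: g_def)
  have "x \<in> g ` R" if x: "x \<in> hi" for x
  proof -
    obtain p t where p: "p \<in> F" "t \<in> T" and q: "shift_diff p\<^sub>1 p t \<noteq> 0"
      and xq: "x = leading_class (shift_diff p\<^sub>1 p t)"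
      using x by (auto simp: hi_def S'_def shift_family_def)
    let ?q = "shift_diff p\<^sub>1 p t"
    have pnz: "p \<noteq> 0" using p nz by auto
    have dq: "e \<le> degree ?q" using x by (simp add: hi_def xq leading_class_def)
    note sd = shift_diff_coeff_ge[OF root[OF p(1)] pnz min[OF p(1)], of t]
    have lt: "lead_coeff p \<noteq> coeff p\<^sub>1 (degree p)"
    proof (cases "degree p = e")
      case True
      with dq sd(1) have "degree ?q = degree p" by simp
      with sd(2) q show ?thesis by (metis diff_0_right eq_iff_diff_eq_0 leading_coeff_0_iff)
    next
      case False
      with min[OF p(1)] have "coeff p\<^sub>1 (degree p) = 0" by (simp add: coeff_eq_0 e_def)
      with pnz show ?thesis by simp
    qed
    with sd(2) have "coeff ?q (degree p) \<noteq> 0" by simp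
    with sd(1) have dq': "degree ?q = degree p" by (simp add: le_antisym le_degree)
    have "x = g (leading_class p)"
      using sd(2) dq' min[OF p(1)]
      by (auto simp: xq leading_class_def g_def c\<^sub>1_def e_def coeff_eq_0)
    moreover have "leading_class p \<noteq> (e, c\<^sub>1)"
      using lt by (auto simp: leading_class_def e_def c\<^sub>1_def)
    ultimately show ?thesis using p x by (auto simp: R_def S_def)
  qed
  then have hi: "hi = g ` R" by (auto simp: R_def)
  have "image_mset fst (mset_set hi) = image_mset fst (image_mset g (mset_set R))"
    unfolding hi using inj by (subst image_mset_mset_set) (auto intro: inj_on_subset)
  also have "\<dots> = image_mset fst (mset_set R)"
    by (simp add: multiset.map_comp comp_def fst_g)
  finally have whi: "image_mset fst (mset_set hi) = image_mset fst (mset_set R)" .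
  have "S' = hi \<union> lo" "hi \<inter> lo = {}" by (auto simp: hi_def lo_def)
  then have w': "poly_weight (shift_family p\<^sub>1 F T)
      = image_mset fst (mset_set R) + image_mset fst (mset_set lo)"
    using finS whi by (simp add: poly_weight_def S'_def[symmetric] mset_set_Union)
  have RS: "R \<subseteq> S" by (auto simp: R_def)
  then have "mset_set S = mset_set R + mset_set (S - R)"
    using finS mset_set_Union[of R "S - R"] by (simp add: Un_absorb1 finite_subset)
  then have w: "poly_weight F
      = image_mset fst (mset_set R) + image_mset fst (mset_set (S - R))"
    by (simp add: poly_weight_def S_def[symmetric])
  have ec: "(e, c\<^sub>1) \<in> S - R" using p1 by (force simp: S_def R_def leading_class_def e_def c\<^sub>1_def)
  show ?thesis
    unfolding w w'
  proof (rule one_step_implies_mult)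
    show "image_mset fst (mset_set (S - R)) \<noteq> {#}" using ec finS by (auto simp: mset_set_empty_iff)
    have "(e, c\<^sub>1) \<in># mset_set (S - R)" using ec finS by simp
    then have "e \<in># image_mset fst (mset_set (S - R))"
      unfolding set_image_mset by (rule image_eqI[rotated]) simp
    then show "\<forall>k\<in>set_mset (image_mset fst (mset_set lo)).
        \<exists>j\<in>set_mset (image_mset fst (mset_set (S - R))). (k, j) \<in> less_than"
      using finS by (intro ballI bexI[of _ e]) (auto simp: lo_def)
  qed
qed

lemma poly_values_bounded:
  fixes F :: "int poly set"
  assumes "finite F"
  obtains M where "M \<ge> 0" "\<And>p t. p \<in> F \<Longrightarrow> t \<in> {0..N} \<Longrightarrow> \<bar>poly p t\<bar> \<le> M"
proof -
  let ?S = "insert 0 ((\<lambda>(p, t). \<bar>poly p t\<bar>) ` (F \<times> {0..N}))"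
  have fin: "finite ?S" using assms by simp
  show thesis
  proof (rule that[of "Max ?S"])
    show "0 \<le> Max ?S" using fin by (intro Max_ge) auto
    show "\<bar>poly p t\<bar> \<le> Max ?S" if "p \<in> F" "t \<in> {0..N}" for p t
      using fin that by (intro Max_ge) (auto intro!: image_eqI[of _ _ "(p, t)"])
  qed
qed

text \<open>
  The colour patterns on a window of radius \<open>M\<close> are finitely many, so they are themselves colours; equal
  pattern colours mean equal colours throughout the window.
\<close>

lemma window_coloring:
  fixes r :: nat and M :: int
  shows "\<exists>(R :: nat) enc. \<forall>\<phi>. (\<forall>i. \<phi> i < r) \<longrightarrow> enc \<phi> < R \<and>
    (\<forall>\<psi>. (\<forall>i. \<psi> i < r) \<longrightarrow> enc \<phi> = enc \<psi> \<longrightarrow> (\<forall>i. \<bar>i\<bar> \<le> M \<longrightarrow> \<phi> i = \<psi> i))"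
proof -
  define l where "l = [-M..M]"
  let ?S = "{xs :: nat list. set xs \<subseteq> {..<r} \<and> length xs = length l}"
  have "finite ?S" by (rule finite_lists_length_eq) simp
  from finite_imp_inj_to_nat_seg[OF this]
  obtain f :: "nat list \<Rightarrow> nat" and R :: nat where f: "f ` ?S = {i. i < R}" "inj_on f ?S"
    by (elim exE conjE) (rule that)
  have mem: "map \<phi> l \<in> ?S" if "\<forall>i. \<phi> i < r" for \<phi>
    using that by (simp add: image_subset_iff)
  show ?thesis
  proof (intro exI[of _ R] exI[of _ "\<lambda>\<phi>. f (map \<phi> l)"] allI impI conjI)
    fix \<phi> :: "int \<Rightarrow> nat"
    assume \<phi>: "\<forall>i. \<phi> i < r"
    show "f (map \<phi> l) < R"
      using imageI[OF mem[OF \<phi>], of f] unfolding f(1) by simp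
    fix \<psi> :: "int \<Rightarrow> nat" and i :: int
    assume \<psi>: "\<forall>i. \<psi> i < r"
      and eq: "f (map \<phi> l) = f (map \<psi> l)" and i: "\<bar>i\<bar> \<le> M"
    have "map \<phi> l = map \<psi> l" by (rule inj_onD[OF f(2) eq mem[OF \<phi>] mem[OF \<psi>]])
    then show "\<phi> i = \<psi> i" using i by (simp add: abs_le_iff l_def)
  qed
qed

text \<open>
  For each \<open>t \<in> D\<close> the points \<open>a + p(t)\<close>, \<open>p \<in> F\<close>, have one colour, and different \<open>t\<close> have different
  colours.  The colour for \<open>t\<close> is read off at \<open>p\<^sub>1\<close>.  The point \<open>a\<close> is the common focus.
\<close>

definition focused :: "int poly set \<Rightarrow> int poly \<Rightarrow> (int \<Rightarrow> nat) \<Rightarrow> int \<Rightarrow> int \<Rightarrow> int set \<Rightarrow> bool" where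
  "focused F p\<^sub>1 \<chi> N a D \<longleftrightarrow> \<bar>a\<bar> \<le> N \<and> D \<subseteq> {1..N} \<and>
     (\<forall>t\<in>D. \<forall>p\<in>F. \<chi> (a + poly p t) = \<chi> (a + poly p\<^sub>1 t)) \<and>
     inj_on (\<lambda>t. \<chi> (a + poly p\<^sub>1 t)) D"

text \<open>
  Move the focus from \<open>b + a\<close> to \<open>b + a - p\<^sub>1(d)\<close> and each step \<open>t\<close> to \<open>t + d\<close>.  The new point for
  \<open>p\<close> and \<open>t\<close> is the old point \<open>b + a + p(t)\<close> translated by the value of \<open>shift_diff p\<^sub>1 p t\<close> at \<open>d\<close>,
  and by assumption such translations preserve the colouring near \<open>b\<close>.  Hence old colours persist.
  The step \<open>t = 0\<close> contributes a further progression in the colour of the old focus; that colour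
  is new, because otherwise the old focus would complete a monochromatic configuration.
\<close>

lemma color_focusing_step:
  fixes \<chi> :: "int \<Rightarrow> nat"
  assumes p1: "p\<^sub>1 \<in> F"
    and foc: "focused F p\<^sub>1 (\<lambda>n. \<chi> (b + n)) N a D"
    and none: "\<not> mono_config F (\<lambda>n. \<chi> (b + n)) N"
    and b: "\<bar>b\<bar> \<le> N'" and d: "1 \<le> d" "d \<le> N'"
    and M: "N \<ge> 0" "\<And>p t. p \<in> F \<Longrightarrow> t \<in> {0..N} \<Longrightarrow> \<bar>poly p t\<bar> \<le> M"
    and M1: "\<bar>poly p\<^sub>1 d\<bar> \<le> M'"
    and shift: "\<And>p t i. p \<in> F \<Longrightarrow> t \<in> {0..N} \<Longrightarrow> \<bar>i\<bar> \<le> N + M \<Longrightarrow>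
      \<chi> (b + poly (shift_diff p\<^sub>1 p t) d + i) = \<chi> (b + i)"
    and root: "\<And>p. p \<in> F \<Longrightarrow> poly p 0 = 0"
  shows "focused F p\<^sub>1 \<chi> (N + N' + M') (b + a - poly p\<^sub>1 d) ((\<lambda>t. t + d) ` insert 0 D)"
proof -
  let ?a = "b + a - poly p\<^sub>1 d"
  have a: "\<bar>a\<bar> \<le> N" and D: "D \<subseteq> {1..N}"
    and mono: "\<And>t p. t \<in> D \<Longrightarrow> p \<in> F \<Longrightarrow> \<chi> (b + (a + poly p t)) = \<chi> (b + (a + poly p\<^sub>1 t))"
    and inj: "inj_on (\<lambda>t. \<chi> (b + (a + poly p\<^sub>1 t))) D"
    using foc by (auto simp: focused_def)
  have col: "\<chi> (?a + poly p (t + d)) = \<chi> (b + (a + poly p t))" if "p \<in> F" "t \<in> insert 0 D" for p t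
  proof -
    have t: "t \<in> {0..N}" using that D M(1) by auto
    have "\<bar>a + poly p t\<bar> \<le> N + M" using a M(2)[OF that(1) t] by linarith
    from shift[OF that(1) t this] show ?thesis
      by (simp add: poly_shift_diff algebra_simps)
  qed
  have new: "\<chi> (b + a) \<noteq> \<chi> (b + (a + poly p\<^sub>1 t))" if "t \<in> D" for t
  proof
    assume "\<chi> (b + a) = \<chi> (b + (a + poly p\<^sub>1 t))"
    with mono[OF that] have "\<forall>p\<in>F. \<chi> (b + (a + poly p t)) = \<chi> (b + a)" by simp
    with a D that none show False by (force simp: mono_config_def)
  qed
  show ?thesis
    unfolding focused_def
  proof (intro conjI)
    show "\<bar>?a\<bar> \<le> N + N' + M'" using a b M1 by linarith
    show "(\<lambda>t. t + d) ` insert 0 D \<subseteq> {1..N + N' + M'}"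
      using D d M M1 by (force simp: image_iff)
    show "\<forall>t\<in>(\<lambda>t. t + d) ` insert 0 D. \<forall>p\<in>F. \<chi> (?a + poly p t) = \<chi> (?a + poly p\<^sub>1 t)"
    proof (intro ballI)
      fix t' p assume "t' \<in> (\<lambda>t. t + d) ` insert 0 D" and p: "p \<in> F"
      then obtain t where t: "t' = t + d" "t \<in> insert 0 D" by blast
      have "\<chi> (b + (a + poly p t)) = \<chi> (b + (a + poly p\<^sub>1 t))"
        using t(2) mono p root p1 by auto
      then show "\<chi> (?a + poly p t') = \<chi> (?a + poly p\<^sub>1 t')"
        unfolding t(1) col[OF p t(2)] col[OF p1 t(2)] .
    qed
    have "inj_on (\<lambda>t. \<chi> (b + (a + poly p\<^sub>1 t))) (insert 0 D)"
      using inj new root[OF p1] by (fastforce simp: inj_on_def)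
    then have "inj_on (\<lambda>t. \<chi> (?a + poly p\<^sub>1 (t + d))) (insert 0 D)"
      using col[OF p1] by (simp add: inj_on_def)
    then show "inj_on (\<lambda>t. \<chi> (?a + poly p\<^sub>1 t)) ((\<lambda>t. t + d) ` insert 0 D)"
      by (auto simp: inj_on_def)
  qed
qed

lemma mono_config_translate:
  assumes "mono_config F (\<lambda>n. \<chi> (b + n)) N" "\<bar>b\<bar> \<le> N'" "N + N' \<le> N''"
  shows "mono_config F \<chi> N''"
proof -
  from assms obtain a d where "\<bar>a\<bar> \<le> N" "1 \<le> d" "d \<le> N"
    "\<forall>p\<in>F. \<chi> (b + (a + poly p d)) = \<chi> (b + a)" by (auto simp: mono_config_def)
  with assms(2,3) show ?thesis
    unfolding mono_config_def
    by (intro exI[of _ "b + a"] exI[of _ d]) (auto simp: algebra_simps)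
qed

text \<open>
  Every possible step \<open>t \<in> {0..N}\<close> is put into the shifted family, since the steps that occur depend on
  the colouring.  The inductive hypothesis is applied to the colouring by window patterns, whose
  radius \<open>N + M\<close> covers all points of a focused configuration of size \<open>N\<close>.
\<close>

lemma color_focusing:
  assumes fin: "finite F" and p1: "p\<^sub>1 \<in> F" and root: "\<And>p. p \<in> F \<Longrightarrow> poly p 0 = 0"
    and IH: "\<And>T. finite T \<Longrightarrow> poly_vdw (shift_family p\<^sub>1 F T)"
  shows "\<exists>N\<ge>0. \<forall>\<chi>. (\<forall>n. \<chi> n < r) \<longrightarrow>
    mono_config F \<chi> N \<or> (\<exists>a D. card D = m \<and> focused F p\<^sub>1 \<chi> N a D)"
proof (induction m)
  case 0
  show ?case by (intro exI[of _ 0]) (auto simp: focused_def intro!: exI[of _ 0] exI[of _ "{}"])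
next
  case (Suc m)
  then obtain N where N: "N \<ge> 0" "\<And>\<chi>. \<forall>n. \<chi> n < r \<Longrightarrow>
      mono_config F \<chi> N \<or> (\<exists>a D. card D = m \<and> focused F p\<^sub>1 \<chi> N a D)" by blast
  obtain M where M: "M \<ge> 0" "\<And>p t. p \<in> F \<Longrightarrow> t \<in> {0..N} \<Longrightarrow> \<bar>poly p t\<bar> \<le> M"
    using poly_values_bounded[OF fin] by blast
  from window_coloring[of r "N + M"]
  obtain R :: nat and enc where enc: "\<forall>\<phi>. (\<forall>i. \<phi> i < r) \<longrightarrow> enc \<phi> < R \<and>
      (\<forall>\<psi>. (\<forall>i. \<psi> i < r) \<longrightarrow> enc \<phi> = enc \<psi> \<longrightarrow> (\<forall>i. \<bar>i\<bar> \<le> N + M \<longrightarrow> \<phi> i = \<psi> i))"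
    by (elim exE) (rule that)
  have window: "\<phi> i = \<psi> i"
    if "\<forall>i. \<phi> i < r" "\<forall>i. \<psi> i < r" "enc \<phi> = enc \<psi>" "\<bar>i\<bar> \<le> N + M" for \<phi> \<psi> i
    using enc that by blast
  let ?G = "shift_family p\<^sub>1 F {0..N}"
  have "poly_vdw ?G" by (rule IH) simp
  then obtain N' where N': "\<And>\<chi>. \<forall>n. \<chi> n < R \<Longrightarrow> mono_config ?G \<chi> N'"
    unfolding poly_vdw_def by blast
  obtain M' where M': "M' \<ge> 0" "\<And>p t. p \<in> F \<Longrightarrow> t \<in> {0..N'} \<Longrightarrow> \<bar>poly p t\<bar> \<le> M'"
    using poly_values_bounded[OF fin] by blast
  define N'' where "N'' = N + \<bar>N'\<bar> + M'"
  have "mono_config F \<chi> N'' \<or> (\<exists>a D. card D = Suc m \<and> focused F p\<^sub>1 \<chi> N'' a D)"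
    if \<chi>: "\<forall>n. \<chi> n < r" for \<chi>
  proof -
    have "\<forall>n. enc (\<lambda>i. \<chi> (n + i)) < R" using enc \<chi> by simp
    from N'[OF this] obtain b d where b: "\<bar>b\<bar> \<le> N'" and d: "1 \<le> d" "d \<le> N'" and
      bd: "\<forall>q\<in>?G. enc (\<lambda>i. \<chi> (b + poly q d + i)) = enc (\<lambda>i. \<chi> (b + i))"
      unfolding mono_config_def by blast
    have shift: "\<chi> (b + poly (shift_diff p\<^sub>1 p t) d + i) = \<chi> (b + i)"
      if "p \<in> F" "t \<in> {0..N}" "\<bar>i\<bar> \<le> N + M" for p t i
    proof (cases "shift_diff p\<^sub>1 p t = 0")
      case False
      with that have "shift_diff p\<^sub>1 p t \<in> ?G" by (force simp: shift_family_def)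
      with bd have "enc (\<lambda>i. \<chi> (b + poly (shift_diff p\<^sub>1 p t) d + i)) = enc (\<lambda>i. \<chi> (b + i))"
        by blast
      from window[OF _ _ this that(3)] \<chi> show ?thesis by simp
    qed simp
    consider "mono_config F (\<lambda>n. \<chi> (b + n)) N"
      | a D where "\<not> mono_config F (\<lambda>n. \<chi> (b + n)) N" "card D = m"
        "focused F p\<^sub>1 (\<lambda>n. \<chi> (b + n)) N a D"
      using N(2)[of "\<lambda>n. \<chi> (b + n)"] \<chi> by blast
    then show ?thesis
    proof cases
      case 1
      then show ?thesis
        using mono_config_translate[OF _ b, of F \<chi> N N''] M'(1) by (simp add: N''_def)
    next
      case 2
      have D: "D \<subseteq> {1..N}" using 2(3) by (simp add: focused_def)
      then have "finite D" by (rule finite_subset) simp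
      with D have "card (insert 0 D) = Suc m" using 2(2) by (subst card_insert_disjoint) auto
      then have "card ((\<lambda>t. t + d) ` insert 0 D) = Suc m" by (subst card_image) auto
      moreover have "focused F p\<^sub>1 \<chi> N'' (b + a - poly p\<^sub>1 d) ((\<lambda>t. t + d) ` insert 0 D)"
        unfolding N''_def
        by (rule color_focusing_step[where M = M, OF p1 2(3,1) _ d(1)])
          (use b d N(1) M M'(2)[OF p1] shift root in auto)
      ultimately show ?thesis by blast
    qed
  qed
  moreover have "N'' \<ge> 0" using N(1) M'(1) by (simp add: N''_def)
  ultimately show ?case by blast
qed

text \<open>
  With \<open>r\<close> colours, \<open>r + 1\<close> differently coloured progressions with a common focus are impossible, so
  colour focusing must have found a monochromatic configuration.
\<close>

theorem polynomial_van_der_waerden: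
  assumes "finite F" "0 \<notin> F" "\<And>p. p \<in> F \<Longrightarrow> poly p 0 = 0"
  shows "poly_vdw F"
proof -
  have "wf (inv_image (mult less_than) poly_weight)" by (simp add: wf_mult)
  then show ?thesis
    using assms
  proof (induction F rule: wf_induct_rule)
    case (less F)
    show ?case
    proof (cases "F = {}")
      case True
      then have "mono_config F \<chi> 1" for \<chi>
        unfolding mono_config_def by (intro exI[of _ 0] exI[of _ 1]) auto
      then show ?thesis unfolding poly_vdw_def by blast
    next
      case False
      then obtain p\<^sub>1 where p1: "p\<^sub>1 \<in> F" and min: "\<And>p. p \<in> F \<Longrightarrow> degree p\<^sub>1 \<le> degree p"
        using ex_has_least_nat[of "\<lambda>p. p \<in> F" _ degree] by blast
      have IH: "poly_vdw (shift_family p\<^sub>1 F T)" if "finite T" for T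
      proof (rule less.IH)
        show "(shift_family p\<^sub>1 F T, F) \<in> inv_image (mult less_than) poly_weight"
          using poly_weight_shift_family[OF less.prems(1) that less.prems(2) p1 min less.prems(3)]
          by simp
        show "finite (shift_family p\<^sub>1 F T)"
          using less.prems(1) that by (simp add: shift_family_def)
        show "0 \<notin> shift_family p\<^sub>1 F T" by (simp add: shift_family_def)
        show "poly q 0 = 0" if "q \<in> shift_family p\<^sub>1 F T" for q
          using that less.prems(3) p1 by (auto simp: shift_family_def poly_shift_diff)
      qed
      show ?thesis
        unfolding poly_vdw_def
      proof
        fix r
        obtain N where N: "\<And>\<chi>. \<forall>n. \<chi> n < r \<Longrightarrow>
            mono_config F \<chi> N \<or> (\<exists>a D. card D = Suc r \<and> focused F p\<^sub>1 \<chi> N a D)"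
          using color_focusing[OF less.prems(1) p1 less.prems(3) IH, where r = r and m = "Suc r"]
          by blast
        have "mono_config F \<chi> N" if \<chi>: "\<forall>n. \<chi> n < r" for \<chi>
        proof (rule ccontr)
          assume "\<not> mono_config F \<chi> N"
          then obtain a D where D: "card D = Suc r" "focused F p\<^sub>1 \<chi> N a D" using N[OF \<chi>] by blast
          then have "card D = card ((\<lambda>t. \<chi> (a + poly p\<^sub>1 t)) ` D)"
            by (simp add: card_image focused_def)
          also have "\<dots> \<le> card {..<r}" using \<chi> by (intro card_mono) auto
          finally show False using D by simp
        qed
        then show "\<exists>N. \<forall>\<chi>. (\<forall>n. \<chi> n < r) \<longrightarrow> mono_config F \<chi> N" by blast
      qed
    qed
  qed
qed

section \<open>Piecewise syndetic sets of positive integers\<close>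

text \<open>
  Arbitrarily long windows in which \<open>B\<close> has gaps of bounded length.  The number \<open>H\<close> bounds both the
  length and the position of the window from below: the windows run off to \<open>+\<infinity>\<close>, so that only
  positive elements matter and these are unbounded.
\<close>

definition piecewise_syndetic :: "int set \<Rightarrow> bool" where
  "piecewise_syndetic B \<longleftrightarrow> (\<exists>L\<ge>0. \<forall>H. \<exists>a\<ge>H. \<forall>n\<in>{a..a + H}. \<exists>b\<in>B. n \<le> b \<and> b \<le> n + L)"

lemma piecewise_syndeticI:
  assumes "L \<ge> 0" "\<And>H. \<exists>a\<ge>H. \<forall>n\<in>{a..a + H}. \<exists>b\<in>B. n \<le> b \<and> b \<le> n + L"
  shows "piecewise_syndetic B"
  unfolding piecewise_syndetic_def using assms by (intro exI[of _ L]) simp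

lemma piecewise_syndetic_unbounded:
  assumes "piecewise_syndetic B"
  shows "\<exists>b\<in>B. b \<ge> K"
proof -
  obtain L where L: "L \<ge> 0" "\<forall>H. \<exists>a\<ge>H. \<forall>n\<in>{a..a + H}. \<exists>b\<in>B. n \<le> b \<and> b \<le> n + L"
    using assms(1) unfolding piecewise_syndetic_def by (elim exE conjE) (rule that)
  obtain a where "a \<ge> \<bar>K\<bar>" and a: "\<forall>n\<in>{a..a + \<bar>K\<bar>}. \<exists>b\<in>B. n \<le> b \<and> b \<le> n + L"
    using spec[OF L(2), of "\<bar>K\<bar>"] by blast
  have "a \<in> {a..a + \<bar>K\<bar>}" by simp
  with a obtain b where "b \<in> B" "a \<le> b" by blast
  with \<open>a \<ge> \<bar>K\<bar>\<close> show ?thesis by (intro bexI[of _ b]) auto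
qed

text \<open>
  If \<open>B\<^sub>2\<close> is not piecewise syndetic with gap bound \<open>L\<close>, then every window of some length \<open>H'\<close> far
  enough to the right contains a gap of \<open>B\<^sub>2\<close> longer than \<open>L\<close>.  Where the union has gaps at most
  \<open>L\<close>, such a gap contains a point of \<open>B\<^sub>1\<close>, so \<open>B\<^sub>1\<close> has gaps at most \<open>H' + L\<close>.
\<close>

lemma piecewise_syndetic_Un:
  assumes "piecewise_syndetic (B\<^sub>1 \<union> B\<^sub>2)"
  shows "piecewise_syndetic B\<^sub>1 \<or> piecewise_syndetic B\<^sub>2"
proof (rule disjCI)
  assume n2: "\<not> piecewise_syndetic B\<^sub>2"
  obtain L where L: "L \<ge> 0"
    "\<forall>H. \<exists>a\<ge>H. \<forall>n\<in>{a..a + H}. \<exists>b\<in>B\<^sub>1 \<union> B\<^sub>2. n \<le> b \<and> b \<le> n + L"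
    using assms(1) unfolding piecewise_syndetic_def by (elim exE conjE) (rule that)
  have "\<exists>H'. \<not> (\<exists>a\<ge>H'. \<forall>n\<in>{a..a + H'}. \<exists>b\<in>B\<^sub>2. n \<le> b \<and> b \<le> n + L)"
    by (rule ccontr) (use n2 piecewise_syndeticI[OF L(1), of B\<^sub>2] in blast)
  then obtain H' where "\<not> (\<exists>a\<ge>H'. \<forall>n\<in>{a..a + H'}. \<exists>b\<in>B\<^sub>2. n \<le> b \<and> b \<le> n + L)" ..
  then have H': "\<exists>n\<in>{a..a + H'}. \<forall>b\<in>B\<^sub>2. \<not> (n \<le> b \<and> b \<le> n + L)" if "a \<ge> H'" for a
    using that by auto
  have "\<exists>a\<ge>H. \<forall>n\<in>{a..a + H}. \<exists>b\<in>B\<^sub>1. n \<le> b \<and> b \<le> n + (\<bar>H'\<bar> + L)" for H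
  proof -
    obtain a where a: "a \<ge> \<bar>H\<bar> + \<bar>H'\<bar>"
      "\<And>n. n \<in> {a..a + (\<bar>H\<bar> + \<bar>H'\<bar>)} \<Longrightarrow> \<exists>b\<in>B\<^sub>1 \<union> B\<^sub>2. n \<le> b \<and> b \<le> n + L"
      using spec[OF L(2), of "\<bar>H\<bar> + \<bar>H'\<bar>"] by blast
    have "\<exists>b\<in>B\<^sub>1. n \<le> b \<and> b \<le> n + (\<bar>H'\<bar> + L)" if n: "n \<in> {a..a + H}" for n
    proof -
      obtain n' where n': "n' \<in> {n..n + H'}" "\<forall>b\<in>B\<^sub>2. \<not> (n' \<le> b \<and> b \<le> n' + L)"
        using H'[of n] a(1) n by force
      obtain b where "b \<in> B\<^sub>1 \<union> B\<^sub>2" "n' \<le> b" "b \<le> n' + L" using a(2)[of n'] n n' by force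
      with n' show ?thesis by (intro bexI[of _ b]) auto
    qed
    with a(1) show ?thesis by (intro exI[of _ a]) auto
  qed
  then show "piecewise_syndetic B\<^sub>1" using L(1) by (intro piecewise_syndeticI[of "\<bar>H'\<bar> + L"]) auto
qed

lemma piecewise_syndetic_UN:
  assumes "finite I" "piecewise_syndetic (\<Union>i\<in>I. B i)"
  shows "\<exists>i\<in>I. piecewise_syndetic (B i)"
  using assms
proof (induction I rule: finite_induct)
  case empty
  then show ?case using piecewise_syndetic_unbounded by fastforce
next
  case (insert i I)
  then show ?case using piecewise_syndetic_Un[of "B i" "\<Union>i\<in>I. B i"] by auto
qed

lemma piecewise_syndetic_dilate:
  assumes "piecewise_syndetic B" "k \<ge> 1"
  shows "piecewise_syndetic ((*) k ` B)"
proof -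
  obtain L where L: "L \<ge> 0" "\<forall>H. \<exists>a\<ge>H. \<forall>n\<in>{a..a + H}. \<exists>b\<in>B. n \<le> b \<and> b \<le> n + L"
    using assms(1) unfolding piecewise_syndetic_def by (elim exE conjE) (rule that)
  have "\<exists>a\<ge>H. \<forall>n\<in>{a..a + H}. \<exists>b\<in>(*) k ` B. n \<le> b \<and> b \<le> n + k * (L + 1)" for H
  proof -
    obtain a where a: "a \<ge> \<bar>H\<bar> + 1"
      "\<And>n. n \<in> {a..a + (\<bar>H\<bar> + 1)} \<Longrightarrow> \<exists>b\<in>B. n \<le> b \<and> b \<le> n + L"
      using spec[OF L(2), of "\<bar>H\<bar> + 1"] by blast
    have "\<exists>b\<in>(*) k ` B. n \<le> b \<and> b \<le> n + k * (L + 1)" if n: "n \<in> {k * a..k * a + H}" for n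
    proof -
      \<comment> \<open>The next multiple of \<open>k\<close> above \<open>n\<close> is \<open>k * m\<close>.\<close>
      define m where "m = n div k + 1"
      have nk: "n = k * (n div k) + n mod k" "0 \<le> n mod k" "n mod k < k" using assms(2) by simp_all
      have m: "n \<le> k * m" "k * m \<le> n + k"
        using nk unfolding m_def distrib_left by linarith+
      have "a \<le> n div k" using n assms(2) zdiv_mono1[of "k * a" n k] by simp
      moreover have "n div k \<le> a + \<bar>H\<bar>"
      proof -
        have "n \<le> k * a + k * \<bar>H\<bar>" using n assms(2) mult_right_mono[of 1 k "\<bar>H\<bar>"] by auto
        also have "\<dots> = k * (a + \<bar>H\<bar>)" by (simp add: distrib_left)
        finally show ?thesis using assms(2) zdiv_mono1[of n "k * (a + \<bar>H\<bar>)" k] by simp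
      qed
      ultimately obtain b where b: "b \<in> B" "m \<le> b" "b \<le> m + L" using a(2)[of m] by (auto simp: m_def)
      have "k * m \<le> k * b" "k * b \<le> k * (m + L)" using b assms(2) by (auto intro: mult_left_mono)
      with m b(1) show ?thesis by (intro bexI[of _ "k * b"]) (auto simp: algebra_simps)
    qed
    moreover have "k * a \<ge> H" using a(1) assms(2) mult_right_mono[of 1 k a] by linarith
    ultimately show ?thesis by blast
  qed
  moreover have "k * (L + 1) \<ge> 0" using L(1) assms(2) by simp
  ultimately show ?thesis by (intro piecewise_syndeticI)
qed

text \<open>
  In a window where \<open>B\<close> has gaps at most \<open>L\<close>, colour each integer by the distance to some element of
  \<open>B\<close> at or above it.  A monochromatic configuration, translated by its colour, lies inside \<open>B\<close>.  So
  the union over \<open>d \<le> N\<close> of the return sets has bounded gaps in long windows, and one of these finitely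
  many sets is piecewise syndetic.
\<close>

lemma piecewise_syndetic_polynomial_recurrence:
  assumes B: "piecewise_syndetic B" and fin: "finite F" and root: "\<And>p. p \<in> F \<Longrightarrow> poly p 0 = 0"
  shows "\<exists>d\<ge>1. piecewise_syndetic {b \<in> B. \<forall>p\<in>F. b + poly p d \<in> B}"
proof -
  obtain L where L: "L \<ge> 0" "\<forall>H. \<exists>a\<ge>H. \<forall>n\<in>{a..a + H}. \<exists>b\<in>B. n \<le> b \<and> b \<le> n + L"
    using B unfolding piecewise_syndetic_def by (elim exE conjE) (rule that)
  have "poly_vdw (F - {0})" using fin root by (intro polynomial_van_der_waerden) auto
  then obtain N where N: "\<And>\<chi>. \<forall>n. \<chi> n < Suc (nat L) \<Longrightarrow> mono_config (F - {0}) \<chi> N"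
    unfolding poly_vdw_def by blast
  have N1: "N \<ge> 1" using N[of "\<lambda>_. 0"] by (auto simp: mono_config_def)
  obtain M where M: "M \<ge> 0" "\<And>p t. p \<in> F \<Longrightarrow> t \<in> {0..N} \<Longrightarrow> \<bar>poly p t\<bar> \<le> M"
    using poly_values_bounded[OF fin] by blast
  let ?R = "\<lambda>d. {b \<in> B. \<forall>p\<in>F. b + poly p d \<in> B}"
  have "\<exists>a\<ge>H. \<forall>n\<in>{a..a + H}. \<exists>b\<in>(\<Union>d\<in>{1..N}. ?R d). n \<le> b \<and> b \<le> n + (2 * N + L)" for H
  proof -
    obtain a where a: "a \<ge> \<bar>H\<bar> + 3 * N + 2 * M"
      "\<And>n. n \<in> {a..a + (\<bar>H\<bar> + 3 * N + 2 * M)} \<Longrightarrow> \<exists>b\<in>B. n \<le> b \<and> b \<le> n + L"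
      using spec[OF L(2), of "\<bar>H\<bar> + 3 * N + 2 * M"] by blast
    \<comment> \<open>The configuration is centred at \<open>n + N\<close>, so that its base point lies in \<open>{n..n + 2 * N}\<close>;
      the margins \<open>N\<close> and \<open>M\<close> keep all its points inside the window.\<close>
    have "\<exists>b\<in>(\<Union>d\<in>{1..N}. ?R d). n \<le> b \<and> b \<le> n + (2 * N + L)"
      if n: "n \<in> {a + M..a + M + H}" for n
    proof -
      define hit where "hit i k \<longleftrightarrow> k \<le> nat L \<and> n + N + i + int k \<in> B" for i k
      \<comment> \<open>Outside the window there may be no hit; the value \<open>0\<close> only keeps the colours bounded.\<close>
      define \<chi> where "\<chi> i = (if \<exists>k. hit i k then SOME k. hit i k else 0)" for i
      have hit: "hit i (\<chi> i)" if i: "- N - M \<le> i" "i \<le> N + M" for i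
      proof -
        have "n + N + i \<in> {a..a + (\<bar>H\<bar> + 3 * N + 2 * M)}" using n i N1 by auto
        then obtain b where "b \<in> B" "n + N + i \<le> b" "b \<le> n + N + i + L"
          using a(2) by blast
        then have "hit i (nat (b - (n + N + i)))" by (auto simp: hit_def)
        then show ?thesis by (auto simp: \<chi>_def intro: someI)
      qed
      have "\<forall>i. \<chi> i < Suc (nat L)"
      proof
        fix i show "\<chi> i < Suc (nat L)"
        proof (cases "\<exists>k. hit i k")
          case True
          then have "hit i (\<chi> i)" by (auto simp: \<chi>_def intro: someI)
          then show ?thesis by (simp add: hit_def)
        qed (simp add: \<chi>_def)
      qed
      from N[OF this] obtain x d where x: "\<bar>x\<bar> \<le> N" and d: "1 \<le> d" "d \<le> N"
        and eq: "\<forall>p\<in>F - {0}. \<chi> (x + poly p d) = \<chi> x"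
        unfolding mono_config_def by blast
      let ?b = "n + N + x + int (\<chi> x)"
      have hx: "hit x (\<chi> x)" using x M(1) by (intro hit) auto
      have "?b + poly p d \<in> B" if p: "p \<in> F" for p
      proof -
        have "\<bar>poly p d\<bar> \<le> M" using M(2)[OF p] d by simp
        then have "hit (x + poly p d) (\<chi> (x + poly p d))" using x by (intro hit) auto
        moreover have "\<chi> (x + poly p d) = \<chi> x" using eq p by (cases "p = 0") auto
        ultimately show ?thesis by (simp add: hit_def algebra_simps)
      qed
      then have "?b \<in> ?R d" using hx by (simp add: hit_def)
      moreover have "n \<le> ?b" "?b \<le> n + (2 * N + L)" using x hx L(1) by (auto simp: hit_def)
      ultimately show ?thesis using d by (intro bexI[of _ ?b]) auto
    qed
    moreover have "a + M \<ge> H" using a(1) M(1) N1 by auto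
    ultimately show ?thesis by blast
  qed
  then have "piecewise_syndetic (\<Union>d\<in>{1..N}. ?R d)"
    using N1 L(1) by (intro piecewise_syndeticI[of "2 * N + L"]) auto
  then obtain d where "d \<in> {1..N}" "piecewise_syndetic (?R d)"
    using piecewise_syndetic_UN[of "{1..N}" ?R] by auto
  then show ?thesis by auto
qed

section \<open>Repetition of colours along products\<close>

text \<open>
  A state of the iteration: \<open>T\<close> is the set of colour classes recorded so far, and \<open>u A\<close> is the product
  of all factors \<open>y\<close> used since the class \<open>A\<close> was recorded.
\<close>

definition tower :: "nat \<Rightarrow> int set set \<Rightarrow> int set \<Rightarrow> (int set \<Rightarrow> int) \<Rightarrow> bool" where
  "tower s T B u \<longleftrightarrow> piecewise_syndetic B \<and> B \<subseteq> {1..} \<and>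
     (\<forall>A\<in>T. u A \<ge> 1 \<and> (\<forall>b\<in>B. \<exists>x\<in>A. b = u A ^ s * x))"

definition abundant_triples :: "nat \<Rightarrow> int poly \<Rightarrow> int set \<Rightarrow> bool" where
  "abundant_triples s P A \<longleftrightarrow> (\<exists>Y\<ge>2. \<exists>B. piecewise_syndetic B \<and>
     (\<forall>b\<in>B. \<exists>x. b = Y ^ s * x \<and> {x, x + poly P Y, b} \<subseteq> A))"

text \<open>
  Let \<open>D\<close> be the set of points of \<open>B\<close> that return to \<open>B\<close> under the recurrence with factor \<open>y\<close>.
  Either the class that receives a large part of \<open>y^s D\<close> has been recorded before, and the
  elements of that part are the products \<open>x Y^s\<close> of triples in it, or the class is added to the tower.
\<close>

lemma tower_step:
  fixes P :: "int poly"
  assumes T: "finite T" and C: "finite C" "\<Union>C = {1..}" and P: "poly P 0 = 0"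
    and tow: "tower s T B u"
  shows "(\<exists>A\<in>T. abundant_triples s P A) \<or>
         (\<exists>A\<in>C - T. \<exists>B' u'. tower s (insert A T) B' u')"
proof -
  have B: "piecewise_syndetic B" "B \<subseteq> {1..}" and u: "\<And>A. A \<in> T \<Longrightarrow> u A \<ge> 1"
    and uB: "\<And>A b. A \<in> T \<Longrightarrow> b \<in> B \<Longrightarrow> \<exists>x\<in>A. b = u A ^ s * x"
    using tow by (auto simp: tower_def)
  \<comment> \<open>The factor \<open>2\<close> turns the step \<open>z \<ge> 1\<close> of the recurrence into a factor \<open>y = 2 * z \<ge> 2\<close>.\<close>
  define f where "f A = smult (u A ^ s) (pcompose P [:0, 2 * u A:])" for A
  have f: "poly (f A) z = u A ^ s * poly P (u A * (2 * z))" for A z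
    by (simp add: f_def poly_pcompose algebra_simps)
  obtain z where z: "z \<ge> 1" and "piecewise_syndetic {b \<in> B. \<forall>p\<in>f ` T. b + poly p z \<in> B}"
    using piecewise_syndetic_polynomial_recurrence[OF B(1), of "f ` T"] T P f by fastforce
  then have D: "piecewise_syndetic {b \<in> B. \<forall>A\<in>T. b + poly (f A) z \<in> B}" (is "piecewise_syndetic ?D")
    by simp
  define y where "y = 2 * z"
  have y: "y \<ge> 2" using z by (simp add: y_def)
  then have ys: "y ^ s \<ge> 1" by simp
  let ?E = "\<lambda>A. (*) (y ^ s) ` ?D \<inter> A"
  have pos: "(*) (y ^ s) ` ?D \<subseteq> {1..}"
  proof (clarsimp)
    fix b assume "b \<in> B"
    then have "b \<ge> 1" using B(2) by auto
    with ys show "1 \<le> y ^ s * b" using mult_mono[of 1 "y ^ s" 1 b] by simp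
  qed
  then have "(*) (y ^ s) ` ?D = (\<Union>A\<in>C. ?E A)" using C(2) by auto
  moreover have "piecewise_syndetic ((*) (y ^ s) ` ?D)" by (rule piecewise_syndetic_dilate[OF D ys])
  ultimately obtain A where A: "A \<in> C" "piecewise_syndetic (?E A)"
    using piecewise_syndetic_UN[OF C(1), of ?E] by auto
  show ?thesis
  proof (cases "A \<in> T")
    case True
    let ?Y = "u A * y"
    have "?Y \<ge> 2" using mult_mono[of 1 "u A" 2 y] u[OF True] y by simp
    moreover have "\<exists>x. b = ?Y ^ s * x \<and> {x, x + poly P ?Y, b} \<subseteq> A" if b: "b \<in> ?E A" for b
    proof -
      obtain d where d: "d \<in> ?D" "b = y ^ s * d" using b by blast
      obtain x where x: "x \<in> A" "d = u A ^ s * x" using uB[OF True] d by blast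
      have "d + poly (f A) z \<in> B" using d True by blast
      then obtain x' where x': "x' \<in> A" "d + poly (f A) z = u A ^ s * x'" using uB[OF True] by blast
      have "u A ^ s * (x + poly P ?Y) = u A ^ s * x'"
        using x(2) x'(2) by (simp add: f y_def algebra_simps)
      moreover have "u A ^ s \<noteq> 0" using u[OF True] by simp
      ultimately have "x + poly P ?Y = x'" by (simp only: mult_cancel_left) blast
      with x'(1) have "x + poly P ?Y \<in> A" by simp
      moreover have "b = ?Y ^ s * x" using d(2) x(2) by (simp add: power_mult_distrib)
      ultimately show ?thesis using x(1) b by blast
    qed
    ultimately have "abundant_triples s P A" using A(2) unfolding abundant_triples_def by blast
    then show ?thesis using True by blast
  next
    case False
    define u' where "u' A' = (if A' = A then 1 else u A' * y)" for A'
    have "tower s (insert A T) (?E A) u'"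
      unfolding tower_def
    proof (intro conjI ballI A(2))
      show "?E A \<subseteq> {1..}" using pos by blast
      fix A' assume A': "A' \<in> insert A T"
      show "u' A' \<ge> 1"
        using A' u[of A'] y mult_mono[of 1 "u A'" 1 y] by (auto simp: u'_def)
      fix b assume b: "b \<in> ?E A"
      show "\<exists>x\<in>A'. b = u' A' ^ s * x"
      proof (cases "A' = A")
        case True
        with b show ?thesis by (simp add: u'_def)
      next
        case neq: False
        with A' have "A' \<in> T" by simp
        moreover obtain d where "d \<in> B" "b = y ^ s * d" using b by blast
        ultimately show ?thesis using uB[of A' d] neq
          by (auto simp: u'_def power_mult_distrib)
      qed
    qed
    then show ?thesis using A(1) False by blast
  qed
qed

text \<open>Otherwise \<open>tower_step\<close> could be repeated to record more classes than there are.\<close>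

lemma abundant_triples_in_some_class:
  fixes P :: "int poly"
  assumes C: "finite C" "\<Union>C = {1..}" and P: "poly P 0 = 0"
  shows "\<exists>A\<in>C. abundant_triples s P A"
proof (rule ccontr)
  assume none: "\<not> (\<exists>A\<in>C. abundant_triples s P A)"
  have "\<exists>T\<subseteq>C. card T = m \<and> (\<exists>B u. tower s T B u)" for m
  proof (induction m)
    case 0
    have "\<exists>a\<ge>H. \<forall>n\<in>{a..a + H}. \<exists>b\<in>{1..}. n \<le> b \<and> b \<le> n + 0" for H :: int
      by (intro exI[of _ "max 1 H"]) auto
    then have "piecewise_syndetic {1..}" by (intro piecewise_syndeticI[of 0]) simp
    then show ?case by (intro exI[of _ "{}"]) (auto simp: tower_def)
  next
    case (Suc m)
    then obtain T B u where T: "T \<subseteq> C" "card T = m" "tower s T B u" by blast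
    have fT: "finite T" using T(1) C(1) by (rule finite_subset)
    obtain A B' u' where "A \<in> C - T" "tower s (insert A T) B' u'"
      using tower_step[OF fT C P T(3)] none T(1) by blast
    with T fT show ?case by (intro exI[of _ "insert A T"]) auto
  qed
  then obtain T where T: "T \<subseteq> C" "card T = Suc (card C)" by blast
  from card_mono[OF C(1) T(1)] T(2) show False by simp
qed

theorem corollary1p2:
  fixes C :: "nat set set" and s :: nat and P :: "int poly"
  assumes "finite_coloring C"
    and "s \<ge> 1"
    and "poly P 0 = 0"
  shows "infinite {(x :: nat, y :: nat). x > y \<and> y \<ge> 2 \<and>
           monochromatic C {int x, int x + poly P (int y), int x * int y ^ s}}"
proof
  let ?S = "{(x :: nat, y :: nat). x > y \<and> y \<ge> 2 \<and>
           monochromatic C {int x, int x + poly P (int y), int x * int y ^ s}}"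
  assume fin: "finite ?S"
  have C: "finite C" "\<Union>C = {1..}" using assms(1) by (auto simp: finite_coloring_def partition_on_def)
  have "(\<Union>A\<in>C. int ` A) = int ` \<Union>C" by blast
  also have "\<dots> = {1..}"
  proof
    show "{1..} \<subseteq> int ` \<Union>C"
    proof
      fix n :: int assume "n \<in> {1..}"
      then show "n \<in> int ` \<Union>C" unfolding C(2) by (intro image_eqI[of _ _ "nat n"]) auto
    qed
  qed (auto simp: C(2))
  finally have "\<Union>((`) int ` C) = {1..}" .
  then obtain A where A: "A \<in> C" and "abundant_triples s P (int ` A)"
    using abundant_triples_in_some_class[of "(`) int ` C" P s] C(1) assms(3) by blast
  from this(2) obtain Y B where Y: "Y \<ge> 2" and B: "piecewise_syndetic B"
    and conf: "\<forall>b\<in>B. \<exists>x. b = Y ^ s * x \<and> {x, x + poly P Y, b} \<subseteq> int ` A"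
    unfolding abundant_triples_def by (elim exE conjE) (rule that)
  define K where "K = Max (insert (nat Y) (fst ` ?S))"
  have fin': "finite (insert (nat Y) (fst ` ?S))" using fin by simp
  \<comment> \<open>This size of \<open>b = Y ^ s * x\<close> forces \<open>x > K\<close>, beyond \<open>Y\<close> and every first component in \<open>?S\<close>.\<close>
  obtain b where b: "b \<in> B" "b \<ge> Y ^ s * (int K + 1)"
    using piecewise_syndetic_unbounded[OF B] by blast
  obtain x where x: "b = Y ^ s * x" "{x, x + poly P Y, b} \<subseteq> int ` A" using conf b(1) by blast
  have xK: "x \<ge> int K + 1" using b(2) Y unfolding x(1) by simp
  have "nat Y \<le> K" unfolding K_def using fin' by (intro Max_ge) auto
  with xK Y x A have "(nat x, nat Y) \<in> ?S" by (auto simp: monochromatic_def mult.commute)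
  then have "nat x \<in> fst ` ?S" by (metis (no_types, lifting) fst_conv image_eqI)
  then have "nat x \<le> K" unfolding K_def using fin' by (intro Max_ge) auto
  with xK show False by linarith
qed

end
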